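(* For every $A\subseteq\mathbb N$, $$\overline{\overline d}(A)=d^*(A)=\overline d_\infty(A)=\overline d_p(A)\quad\text{and}\quad \underline{\underline d}(A)=d_*(A)=\underline d_\infty(A)=\underline d_p(A).$$
   Context: $\mathbb N=\{1,2,\dots\}$. For $A\subseteq\mathbb N$, $A(n)=|A\cap\{1,\dots,n\}|$ (for real $r>0$, $A(r)=|A\cap[1,r]|$), and $A$ has asymptotic density $d(A)=\lim_n A(n)/n$ if the limit exists; $\mathcal D$ is the class of sets having asymptotic density. A density measure is a finitely additive measure $\mu:\mathcal P(\mathbb N)\to[0,1]$ with $\mu(A)=d(A)$ for all $A\in\mathcal D$; $\mathrm{DM}$ is the set of all density measures. Define $\overline{\overline d}(A)=\sup\{\mu(A):\mu\in\mathrm{DM}\}$, $\underline{\underline d}(A)=\inf\{\mu(A):\mu\in\mathrm{DM}\}$, $d^*(A)=\inf\{d(B): B\supseteq A, B\in\mathcal D\}$, $d_*(A)=\sup\{d(B): B\subseteq A, B\in\mathcal D\}$. For $\alpha\in\mathbb R$ let $A_\alpha(n)=\sum_{k\in A,k\le n}k^\alpha$, and $\overline d_\infty(A)=\lim_{\alpha\to\infty}\limsup_{n\to\infty}A_\alpha(n)/\mathbb N_\alpha(n)$, $\underline d_\infty(A)=\lim_{\alpha\to\infty}\liminf_{n\to\infty}A_\alpha(n)/\mathbb N_\alpha(n)$. Further $\overline d_p(A)=\lim_{\theta\to1^-}\limsup_{n\to\infty}\frac{A(n)-A(\theta n)}{n-\theta n}$ and $\underline d_p(A)=\lim_{\theta\to1^-}\liminf_{n\to\infty}\frac{A(n)-A(\theta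 n)}{n-\theta n}$ (these limits exist). *)

theory Defs
  imports "HOL-Analysis.Analysis"
begin

abbreviation posnats :: "nat set" where
  "posnats \<equiv> {1..}"

definition counting :: "nat set \<Rightarrow> real \<Rightarrow> nat" where
  "counting A r = card {k \<in> A. 1 \<le> k \<and> real k \<le> r}"

definition density_seq :: "nat set \<Rightarrow> nat \<Rightarrow> real" where
  "density_seq A n = real (counting A (real n)) / real n"

definition asymp_density :: "nat set \<Rightarrow> real" where
  "asymp_density A = lim (density_seq A)"

definition has_asymp_density :: "nat set set" where
  "has_asymp_density = {A. A \<subseteq> posnats \<and> convergent (density_seq A)}"

(* A density measure lives on the power set of posnats; its values at sets containing 0
   are left unconstrained and never used. *)
definition density_measures :: "(nat set \<Rightarrow> real) set" where
  "density_measures = {\<mu>. \<mu> \<in> Pow posnats \<rightarrow> {0..1} \<and> additive (Pow posnats) \<mu> \<and>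
     (\<forall>A \<in> has_asymp_density. \<mu> A = asymp_density A)}"

(* All densities below take values in ereal, a complete lattice, so that limsup, liminf,
   suprema and infima are total. *)

definition upper_dm :: "nat set \<Rightarrow> ereal" where
  "upper_dm A = (SUP \<mu> \<in> density_measures. ereal (\<mu> A))"

definition lower_dm :: "nat set \<Rightarrow> ereal" where
  "lower_dm A = (INF \<mu> \<in> density_measures. ereal (\<mu> A))"

definition upper_star :: "nat set \<Rightarrow> ereal" where
  "upper_star A = (INF B \<in> {B \<in> has_asymp_density. A \<subseteq> B}. ereal (asymp_density B))"

definition lower_star :: "nat set \<Rightarrow> ereal" where
  "lower_star A = (SUP B \<in> {B \<in> has_asymp_density. B \<subseteq> A}. ereal (asymp_density B))"

definition weighted_sum :: "real \<Rightarrow> nat set \<Rightarrow> nat \<Rightarrow> real" where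
  "weighted_sum \<alpha> A n = (\<Sum>k \<in> A \<inter> {1..n}. real k powr \<alpha>)"

definition upper_weighted :: "nat set \<Rightarrow> real \<Rightarrow> ereal" where
  "upper_weighted A \<alpha> = limsup (\<lambda>n. ereal (weighted_sum \<alpha> A n / weighted_sum \<alpha> posnats n))"

definition lower_weighted :: "nat set \<Rightarrow> real \<Rightarrow> ereal" where
  "lower_weighted A \<alpha> = liminf (\<lambda>n. ereal (weighted_sum \<alpha> A n / weighted_sum \<alpha> posnats n))"

definition upper_infty :: "nat set \<Rightarrow> ereal" where
  "upper_infty A = Lim at_top (upper_weighted A)"

definition lower_infty :: "nat set \<Rightarrow> ereal" where
  "lower_infty A = Lim at_top (lower_weighted A)"

definition window_ratio :: "nat set \<Rightarrow> real \<Rightarrow> nat \<Rightarrow> real" where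
  "window_ratio A \<theta> n =
     (real (counting A (real n)) - real (counting A (\<theta> * real n))) / (real n - \<theta> * real n)"

definition upper_window :: "nat set \<Rightarrow> real \<Rightarrow> ereal" where
  "upper_window A \<theta> = limsup (\<lambda>n. ereal (window_ratio A \<theta> n))"

definition lower_window :: "nat set \<Rightarrow> real \<Rightarrow> ereal" where
  "lower_window A \<theta> = liminf (\<lambda>n. ereal (window_ratio A \<theta> n))"

definition upper_polya :: "nat set \<Rightarrow> ereal" where
  "upper_polya A = Lim (at_left 1) (upper_window A)"

definition lower_polya :: "nat set \<Rightarrow> ereal" where
  "lower_polya A = Lim (at_left 1) (lower_window A)"

end

theory Submission
  imports Defs
begin

text \<open>All quantities on the upper side are governed by one condition, \<open>increment_bound A c\<close>: the
  number of elements of \<open>A\<close> in \<open>(m, n]\<close> is at most \<open>c (n - m) + o(n)\<close>, uniformly in \<open>m \<le> n\<close>.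
  It passes to subsets of a set with density \<open>c\<close>, and conversely a reflection construction embeds
  every set satisfying it into a set of density \<open>c\<close>. It bounds every window and weighted upper density
  by \<open>c\<close>; conversely it follows if those densities are below \<open>c\<close> for \<open>\<theta>\<close> arbitrarily close to 1
  (chain the windows), respectively for \<open>\<alpha>\<close> arbitrarily large (Abel summation). If it fails,
  a cluster point of averages over suitable windows is a density measure giving \<open>A\<close> mass at least
  \<open>c\<close>. The lower densities follow by passing to complements.\<close>

section \<open>Counting function at natural arguments and its increments\<close>

text \<open>A version of \<open>counting\<close> with a natural argument, so that its facts follow
  by induction on n.\<close>

definition cnt :: "nat set \<Rightarrow> nat \<Rightarrow> nat" where
  "cnt A n = card (A \<inter> {1..n})"

lemma cnt_0 [simp]: "cnt A 0 = 0"
  by (simp add: cnt_def)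

lemma cnt_Suc: "cnt A (Suc n) = cnt A n + (if Suc n \<in> A then 1 else 0)"
proof (cases "Suc n \<in> A")
  case True
  then have "A \<inter> {1..Suc n} = insert (Suc n) (A \<inter> {1..n})"
    by auto
  with True show ?thesis
    by (simp add: cnt_def)
next
  case False
  then have "A \<inter> {1..Suc n} = A \<inter> {1..n}"
    by (auto simp: le_Suc_eq)
  with False show ?thesis
    by (simp add: cnt_def)
qed

lemma counting_eq_cnt:
  assumes "0 \<le> r"
  shows "counting A r = cnt A (nat \<lfloor>r\<rfloor>)"
proof -
  have "{k \<in> A. 1 \<le> k \<and> real k \<le> r} = A \<inter> {1..nat \<lfloor>r\<rfloor>}"
    using assms by (auto simp: le_nat_floor nat_le_iff le_nat_iff le_floor_iff)
  then show ?thesis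
    by (simp add: counting_def cnt_def)
qed

lemma density_seq_eq: "density_seq A n = real (cnt A n) / real n"
  by (simp add: density_seq_def counting_eq_cnt)

lemma cnt_increment_mono:
  assumes "A \<subseteq> B" "m \<le> n"
  shows "real (cnt A n) - real (cnt A m) \<le> real (cnt B n) - real (cnt B m)"
  using assms(2) by (induction rule: dec_induct) (use assms(1) in \<open>auto simp: cnt_Suc\<close>)

lemma cnt_mono: "m \<le> n \<Longrightarrow> cnt A m \<le> cnt A n"
  unfolding cnt_def by (rule card_mono) auto

lemma cnt_increment_le:
  "m \<le> n \<Longrightarrow> real (cnt A n) - real (cnt A m) \<le> real n - real m"
  by (induction rule: dec_induct) (auto simp: cnt_Suc)

lemma cnt_le: "cnt A n \<le> n"
  using cnt_increment_le[of 0 n A] by simp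

lemma cnt_posnats: "cnt posnats n = n"
  by (induction n) (auto simp: cnt_Suc)

lemma cnt_Un_disjoint: "A \<inter> B = {} \<Longrightarrow> cnt (A \<union> B) n = cnt A n + cnt B n"
  by (induction n) (auto simp: cnt_Suc)

section \<open>Asymptotic density as a linear estimate for the counting function\<close>

text \<open>The multiplied-out form of convergence: K absorbs finitely many exceptional n, including
  n = 0. No threshold remains, so estimates at two endpoints can simply be subtracted.\<close>

lemma density_seq_tendstoI:
  assumes "\<And>e. 0 < e \<Longrightarrow> \<exists>K. \<forall>n. \<bar>real (cnt A n) - d * real n\<bar> \<le> e * real n + K"
  shows "density_seq A \<longlonglongrightarrow> d"
proof (rule LIMSEQ_I)
  fix r :: real
  assume "0 < r"
  then obtain K where K: "\<And>n. \<bar>real (cnt A n) - d * real n\<bar> \<le> r / 2 * real n + K"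
    using assms[of "r / 2"] by auto
  have "norm (density_seq A n - d) < r" if n: "n \<ge> Suc (nat \<lceil>2 * K / r\<rceil>)" for n
  proof -
    have n0: "real n > 0"
      using n by simp
    have "2 * K / r < real n"
      using n by linarith
    then have "K < r / 2 * real n"
      using \<open>0 < r\<close> by (simp add: field_simps)
    with K[of n] have "\<bar>real (cnt A n) - d * real n\<bar> < r * real n"
      by (simp add: field_simps)
    moreover have "density_seq A n - d = (real (cnt A n) - d * real n) / real n"
      using n0 by (simp add: density_seq_eq field_simps)
    ultimately show ?thesis
      using n0 by (simp add: abs_divide pos_divide_less_eq)
  qed
  then show "\<exists>no. \<forall>n\<ge>no. norm (density_seq A n - d) < r"
    by blast
qed

lemma density_seq_tendstoD:
  assumes "density_seq A \<longlonglongrightarrow> d" "0 < e"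
  shows "\<exists>K. \<forall>n. \<bar>real (cnt A n) - d * real n\<bar> \<le> e * real n + K"
proof -
  obtain N where N: "\<And>n. n \<ge> N \<Longrightarrow> \<bar>density_seq A n - d\<bar> < e"
    using LIMSEQ_D[OF assms] by auto
  \<comment> \<open>Below the threshold the error is at most (1 + |d|) * n, because
    \<open>cnt A n\<close> is at most n; this explains the constant.\<close>
  have "\<bar>real (cnt A n) - d * real n\<bar> \<le> e * real n + (1 + \<bar>d\<bar>) * real N" for n
  proof (cases "n \<ge> N \<and> n > 0")
    case True
    then have "\<bar>real (cnt A n) - d * real n\<bar> / real n = \<bar>density_seq A n - d\<bar>"
      by (simp add: density_seq_eq field_simps flip: abs_div_pos)
    then have "\<bar>real (cnt A n) - d * real n\<bar> \<le> e * real n"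
      using True N[of n] by (simp add: field_simps)
    moreover have "0 \<le> (1 + \<bar>d\<bar>) * real N"
      by simp
    ultimately show ?thesis
      by linarith
  next
    case False
    then have "n \<le> N"
      by auto
    have "\<bar>real (cnt A n) - d * real n\<bar> \<le> real n + \<bar>d\<bar> * real n"
      using cnt_le[of A n] abs_triangle_ineq4[of "real (cnt A n)" "d * real n"] by (simp add: abs_mult)
    also have "\<dots> = (1 + \<bar>d\<bar>) * real n"
      by (simp add: algebra_simps)
    also have "\<dots> \<le> (1 + \<bar>d\<bar>) * real N"
      using \<open>n \<le> N\<close> by (intro mult_left_mono) auto
    also have "\<dots> \<le> e * real n + (1 + \<bar>d\<bar>) * real N"
      using assms(2) by simp
    finally show ?thesis .
  qed
  then show ?thesis
    by blast
qed

lemma has_asymp_densityD: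
  "A \<in> has_asymp_density \<Longrightarrow> density_seq A \<longlonglongrightarrow> asymp_density A"
  by (simp add: has_asymp_density_def asymp_density_def convergent_LIMSEQ_iff)

lemma has_asymp_densityI:
  assumes "A \<subseteq> posnats" "density_seq A \<longlonglongrightarrow> d"
  shows "A \<in> has_asymp_density" "asymp_density A = d"
  using assms by (auto simp: has_asymp_density_def asymp_density_def convergent_def limI)

lemma posnats_density: "posnats \<in> has_asymp_density" "asymp_density posnats = 1"
proof -
  have "density_seq posnats \<longlonglongrightarrow> 1"
    by (rule density_seq_tendstoI, rule exI[of _ 0]) (simp only: cnt_posnats, simp)
  then show "posnats \<in> has_asymp_density" "asymp_density posnats = 1"
    using has_asymp_densityI by blast+
qed

section \<open>The increment bound and the density \<open>upper_star\<close>\<close>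

text \<open>The error is measured against the right endpoint n and not against n - m. Hence, for c
  \<ge> 0, windows of length o(n) satisfy the bound automatically.\<close>

definition increment_bound :: "nat set \<Rightarrow> real \<Rightarrow> bool" where
  "increment_bound A c \<longleftrightarrow> (\<forall>e>0. \<exists>K. \<forall>n. \<forall>m\<le>n.
     real (cnt A n) - real (cnt A m) \<le> c * (real n - real m) + e * real n + K)"

text \<open>Increments of \<open>A\<close> are at most those of \<open>B\<close>, and replacing
  \<open>cnt B\<close> by its linear approximation costs at most e / 2 * n + K at each
  endpoint.\<close>

lemma increment_bound_of_superset:
  assumes "B \<in> has_asymp_density" "A \<subseteq> B"
  shows "increment_bound A (asymp_density B)"
  unfolding increment_bound_def
proof (intro allI impI)
  fix e :: real
  assume "e > 0"
  define d where "d = asymp_density B"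
  obtain K where K: "\<And>n. \<bar>real (cnt B n) - d * real n\<bar> \<le> e / 2 * real n + K"
    using density_seq_tendstoD[OF has_asymp_densityD[OF assms(1)], of "e / 2"] \<open>e > 0\<close> d_def by auto
  have "real (cnt A n) - real (cnt A m) \<le> d * (real n - real m) + e * real n + 2 * K"
    if "m \<le> n" for m n
  proof -
    have "e / 2 * real m \<le> e / 2 * real n"
      using that \<open>e > 0\<close> by (intro mult_left_mono) auto
    with K[of n] K[of m] cnt_increment_mono[OF assms(2) that] show ?thesis
      by (simp add: algebra_simps abs_le_iff)
  qed
  then show "\<exists>K. \<forall>n. \<forall>m\<le>n. real (cnt A n) - real (cnt A m)
      \<le> asymp_density B * (real n - real m) + e * real n + K"
    unfolding d_def by blast
qed

text \<open>The witness is a reflection construction: a new point is added to \<open>A\<close> exactly when the integer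
  part of the running maximum \<open>M n\<close> of \<open>c * m - cnt A m\<close> jumps, so that \<open>cnt B n = cnt A n + \<lfloor>M n\<rfloor>\<close>
  stays above \<open>c * n - 1\<close>.\<close>

lemma superset_of_density:
  assumes "A \<subseteq> posnats" "increment_bound A c" "0 \<le> c" "c \<le> 1"
  obtains B where "A \<subseteq> B" "B \<in> has_asymp_density" "asymp_density B = c"
proof -
  define g where "g m = c * real m - real (cnt A m)" for m
  define M where "M n = Max (g ` {..n})" for n
  define B where "B = A \<union> {Suc n |n. \<lfloor>M (Suc n)\<rfloor> \<noteq> \<lfloor>M n\<rfloor>}"
  have M_Suc: "M (Suc n) = max (M n) (g (Suc n))" for n
    by (simp add: M_def atMost_Suc max.commute)
  have g_le: "g m \<le> M n" if "m \<le> n" for m n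
    unfolding M_def using that by (intro Max_ge) auto
  have M_0: "M 0 = 0"
    by (simp add: M_def g_def)
  have M_attained: "\<exists>m\<le>n. M n = g m" for n
    using Max_in[of "g ` {..n}"] unfolding M_def by fastforce
  have cnt_B: "int (cnt B n) = int (cnt A n) + \<lfloor>M n\<rfloor>" for n
  proof (induction n)
    case 0
    then show ?case
      by (simp add: M_0)
  next
    case (Suc n)
    have "g n \<le> M n"
      by (simp add: g_le)
    show ?case
    proof (cases "Suc n \<in> A")
      \<comment> \<open>At a point of \<open>A\<close> the function \<open>g\<close> drops by 1 - c
        \<ge> 0, so the maximum does not move and no second point is requested here.\<close>
      case True
      then have "g (Suc n) = g n + c - 1"
        by (simp add: g_def cnt_Suc algebra_simps)
      then have "M (Suc n) = M n"
        using \<open>g n \<le> M n\<close> assms(4) by (simp add: M_Suc)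
      moreover have "Suc n \<in> B"
        using True by (simp add: B_def)
      ultimately show ?thesis
        using Suc True by (simp add: cnt_Suc)
    next
      \<comment> \<open>Off \<open>A\<close> the maximum grows by at most c \<le> 1, so its integer
        part jumps by at most 1 and the single new point suffices.\<close>
      case False
      then have "g (Suc n) = g n + c"
        by (simp add: g_def cnt_Suc algebra_simps)
      then have "M n \<le> M (Suc n)" "M (Suc n) \<le> M n + 1"
        using \<open>g n \<le> M n\<close> assms(3,4) by (auto simp: M_Suc)
      then have "\<lfloor>M (Suc n)\<rfloor> = \<lfloor>M n\<rfloor> \<or> \<lfloor>M (Suc n)\<rfloor> = \<lfloor>M n\<rfloor> + 1"
        by linarith
      moreover have "Suc n \<in> B \<longleftrightarrow> \<lfloor>M (Suc n)\<rfloor> \<noteq> \<lfloor>M n\<rfloor>"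
        using False by (auto simp: B_def)
      ultimately show ?thesis
        using Suc False by (auto simp: cnt_Suc)
    qed
  qed
  have "density_seq B \<longlonglongrightarrow> c"
  proof (rule density_seq_tendstoI)
    fix e :: real
    assume "e > 0"
    then obtain K where K: "\<And>n m. m \<le> n \<Longrightarrow>
        real (cnt A n) - real (cnt A m) \<le> c * (real n - real m) + e * real n + K"
      using assms(2) unfolding increment_bound_def by blast
    have "\<bar>real (cnt B n) - c * real n\<bar> \<le> e * real n + (\<bar>K\<bar> + 1)" for n
    proof -
      \<comment> \<open>The upper estimate is the increment bound on (m, n], where m attains the
        maximum: \<open>cnt A n + M n\<close> equals \<open>cnt A n - cnt A m\<close> plus c *
        m.\<close>
      obtain m where m: "m \<le> n" "M n = g m"
        using M_attained by blast
      have B: "real (cnt B n) = real (cnt A n) + real_of_int \<lfloor>M n\<rfloor>"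
        using arg_cong[OF cnt_B[of n], of real_of_int] by simp
      have "real (cnt A n) + M n \<le> c * real n + e * real n + K"
        using K[OF m(1)] by (simp add: m(2) g_def algebra_simps)
      moreover have "c * real n \<le> real (cnt A n) + M n"
        using g_le[of n n] by (simp add: g_def)
      moreover have "0 \<le> e * real n"
        using \<open>e > 0\<close> by simp
      ultimately show ?thesis
        unfolding B by linarith
    qed
    then show "\<exists>K. \<forall>n. \<bar>real (cnt B n) - c * real n\<bar> \<le> e * real n + K"
      by blast
  qed
  moreover have "B \<subseteq> posnats" "A \<subseteq> B"
    using assms(1) by (auto simp: B_def)
  ultimately show thesis
    using has_asymp_densityI[of B c] that by blast
qed

text \<open>For negative c, taking m = 0 and e = - c / 2 would bound the nonnegative
  \<open>cnt A n\<close> by c / 2 * n + K, which tends to minus infinity.\<close>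

lemma increment_bound_nonneg:
  assumes "increment_bound A c"
  shows "0 \<le> c"
proof (rule ccontr)
  assume "\<not> 0 \<le> c"
  then obtain K where K: "\<And>n m. m \<le> n \<Longrightarrow>
      real (cnt A n) - real (cnt A m) \<le> c * (real n - real m) + - c / 2 * real n + K"
    using assms unfolding increment_bound_def by (metis not_le half_gt_zero neg_0_less_iff_less)
  obtain n where n: "2 * K / - c < real n"
    using reals_Archimedean2 by blast
  then have "K < - c / 2 * real n"
    using \<open>\<not> 0 \<le> c\<close> by (simp add: field_simps)
  then show False
    using K[of 0 n] by (simp add: field_simps)
qed

text \<open>Together with \<open>le_upper_star\<close> this makes \<open>upper_star A\<close> the
  infimum of all c with \<open>increment_bound A c\<close>. For c > 1 the superset
  \<open>posnats\<close> of density 1 serves.\<close>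

lemma upper_star_le:
  assumes "A \<subseteq> posnats" "increment_bound A c"
  shows "upper_star A \<le> ereal c"
proof -
  have "\<exists>B. B \<in> has_asymp_density \<and> A \<subseteq> B \<and> asymp_density B \<le> c"
  proof (cases "c \<le> 1")
    case True
    then show ?thesis
      using superset_of_density[OF assms increment_bound_nonneg[OF assms(2)]] by blast
  next
    case False
    then show ?thesis
      using posnats_density assms(1) by (intro exI[of _ posnats]) simp
  qed
  then show ?thesis
    unfolding upper_star_def by (auto intro!: INF_lower2)
qed

lemma le_upper_star:
  assumes "\<And>c. increment_bound A c \<Longrightarrow> x \<le> ereal c"
  shows "x \<le> upper_star A"
  unfolding upper_star_def
  by (rule INF_greatest) (use assms increment_bound_of_superset in auto)

section \<open>Criteria for limsup bounds and for convergence\<close>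

text \<open>Divided by n, an error e * n + K becomes e + K / n; the second term vanishes in the
  limit and e is arbitrary.\<close>

lemma limsup_le_if_bound:
  fixes f :: "nat \<Rightarrow> real"
  assumes "\<And>e. 0 < e \<Longrightarrow> \<exists>K. \<forall>\<^sub>F n in sequentially. f n \<le> c + e + K / real n"
  shows "limsup (\<lambda>n. ereal (f n)) \<le> ereal c"
proof (rule ereal_le_epsilon2)
  fix e :: real
  assume "0 < e"
  then obtain K where K: "\<forall>\<^sub>F n in sequentially. f n \<le> c + e + K / real n"
    using assms by blast
  have "(\<lambda>n. K / real n) \<longlonglongrightarrow> 0"
    by (rule lim_const_over_n)
  then have "(\<lambda>n. c + e + K / real n) \<longlonglongrightarrow> c + e"
    by (auto intro!: tendsto_eq_intros)
  then have "limsup (\<lambda>n. ereal (c + e + K / real n)) = ereal (c + e)"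
    by (intro lim_imp_Limsup) auto
  moreover have "limsup (\<lambda>n. ereal (f n)) \<le> limsup (\<lambda>n. ereal (c + e + K / real n))"
    by (rule Limsup_mono) (use K in \<open>simp\<close>)
  ultimately show "limsup (\<lambda>n. ereal (f n)) \<le> ereal c + ereal e"
    by simp
qed

lemma eventually_less_if_limsup_less:
  "limsup (\<lambda>n. ereal (f n)) < ereal c \<Longrightarrow> \<forall>\<^sub>F n in sequentially. f n < c"
  by (drule Limsup_lessD) simp

text \<open>Yields convergence without any monotonicity of \<open>f\<close>: if \<open>f\<close> did
  not eventually exceed some a < U, it would frequently lie below a real c with a < c < U, contrary
  to the second hypothesis.\<close>

lemma tendsto_if_frequently_bound:
  fixes f :: "'a \<Rightarrow> ereal"
  assumes "\<forall>\<^sub>F x in F. f x \<le> U"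
    and "\<And>c. \<exists>\<^sub>F x in F. f x < ereal c \<Longrightarrow> U \<le> ereal c"
  shows "(f \<longlongrightarrow> U) F"
proof (rule order_tendstoI)
  fix a
  assume "a < U"
  then obtain c where c: "a < ereal c" "ereal c < U"
    using ereal_dense2 by blast
  show "\<forall>\<^sub>F x in F. a < f x"
  proof (rule ccontr)
    assume "\<not> ?thesis"
    then have "\<exists>\<^sub>F x in F. f x \<le> a"
      by (simp add: frequently_def not_le)
    then have "\<exists>\<^sub>F x in F. f x < ereal c"
      by (rule frequently_elim1) (use c in auto)
    with assms(2) c(2) show False
      by fastforce
  qed
next
  fix a
  assume "U < a"
  with assms(1) show "\<forall>\<^sub>F x in F. f x < a"
    by (auto elim: eventually_mono)
qed

section \<open>Window densities as \<theta> tends to 1\<close>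

lemma window_ratio_eq:
  assumes "0 \<le> \<theta>"
  shows "window_ratio A \<theta> n =
    (real (cnt A n) - real (cnt A (nat \<lfloor>\<theta> * real n\<rfloor>))) / ((1 - \<theta>) * real n)"
  using assms by (simp add: window_ratio_def counting_eq_cnt algebra_simps)

lemma window_floor:
  assumes "0 < \<theta>" "\<theta> < 1"
  shows "nat \<lfloor>\<theta> * real n\<rfloor> \<le> n" "real (nat \<lfloor>\<theta> * real n\<rfloor>) \<le> \<theta> * real n"
    "\<theta> * real n < real (nat \<lfloor>\<theta> * real n\<rfloor>) + 1"
proof -
  show *: "real (nat \<lfloor>\<theta> * real n\<rfloor>) \<le> \<theta> * real n"
    using assms by (intro of_nat_floor) auto
  have "0 \<le> \<theta> * real n"
    using assms by simp
  then show "\<theta> * real n < real (nat \<lfloor>\<theta> * real n\<rfloor>) + 1"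
    by linarith
  have "\<theta> * real n \<le> real n"
    using assms by (simp add: mult_left_le_one_le)
  with * show "nat \<lfloor>\<theta> * real n\<rfloor> \<le> n"
    by linarith
qed

lemma upper_window_le:
  assumes "increment_bound A c" "0 < \<theta>" "\<theta> < 1"
  shows "upper_window A \<theta> \<le> ereal c"
  unfolding upper_window_def
proof (rule limsup_le_if_bound)
  fix e :: real
  assume "0 < e"
  \<comment> \<open>Scaled so that division by the window length (1 - \<theta>) * n leaves the error
    e.\<close>
  then have "0 < (1 - \<theta>) * e"
    using assms by simp
  then obtain K where K: "\<And>n m. m \<le> n \<Longrightarrow> real (cnt A n) - real (cnt A m)
      \<le> c * (real n - real m) + (1 - \<theta>) * e * real n + K"
    using assms(1) unfolding increment_bound_def by blast
  have "window_ratio A \<theta> n \<le> c + e + ((c + K) / (1 - \<theta>)) / real n" if "n > 0" for n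
  proof -
    let ?m = "nat \<lfloor>\<theta> * real n\<rfloor>"
    \<comment> \<open>Rounding \<theta> * n down lengthens the window by less than 1, which costs
      the extra constant c.\<close>
    have "c * (real n - real ?m) \<le> c * ((1 - \<theta>) * real n + 1)"
      using window_floor[OF assms(2,3), of n] increment_bound_nonneg[OF assms(1)]
      by (intro mult_left_mono) (auto simp: algebra_simps)
    then have "real (cnt A n) - real (cnt A ?m) \<le> (c + e) * ((1 - \<theta>) * real n) + (c + K)"
      using K[OF window_floor(1)[OF assms(2,3)], of n] by (simp add: algebra_simps)
    then have "window_ratio A \<theta> n \<le> ((c + e) * ((1 - \<theta>) * real n) + (c + K)) / ((1 - \<theta>) * real n)"
      unfolding window_ratio_eq[OF less_imp_le[OF assms(2)]]
      using assms(3) that by (intro divide_right_mono) auto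
    also have "\<dots> = c + e + ((c + K) / (1 - \<theta>)) / real n"
      using assms(3) that by (simp add: add_divide_distrib)
    finally show ?thesis .
  qed
  then have "\<forall>\<^sub>F n in sequentially. window_ratio A \<theta> n \<le> c + e + ((c + K) / (1 - \<theta>)) / real n"
    by (rule eventually_mono[OF eventually_gt_at_top[of "0::nat"]])
  then show "\<exists>K. \<forall>\<^sub>F n in sequentially. window_ratio A \<theta> n \<le> c + e + K / real n"
    by blast
qed

text \<open>Rounding \<open>\<theta> n\<close> down only enlarges the window, so chaining the windows
  \<open>n, \<lfloor>\<theta> n\<rfloor>, \<lfloor>\<theta> \<lfloor>\<theta> n\<rfloor>\<rfloor>, \<dots>\<close> down to \<open>m\<close> accumulates no error except in the last,
  incomplete window.\<close>

lemma increment_le_if_window_le: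
  assumes "0 < \<theta>" "\<theta> < 1" "0 \<le> c"
    and window: "\<And>n. n \<ge> N \<Longrightarrow> window_ratio A \<theta> n \<le> c"
  shows "m \<le> n \<Longrightarrow> real (cnt A n) - real (cnt A m)
    \<le> c * (real n - real m) + (1 - \<theta>) * real n + (real N + 1)"
proof (induction n rule: less_induct)
  case (less n)
  let ?k = "nat \<lfloor>\<theta> * real n\<rfloor>"
  note k = window_floor[OF assms(1,2), of n]
  have pos: "0 \<le> c * (real n - real m)" "0 \<le> (1 - \<theta>) * real n"
    using assms less.prems by auto
  have triv: "real (cnt A n) - real (cnt A m) \<le> real n - real m"
    by (rule cnt_increment_le[OF less.prems])
  show ?case
  proof (cases "m < ?k \<and> N \<le> n")
    case True
    then have "n > 0"
      using k by linarith
    then have "?k < n"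
      using k(2) assms(2) by (metis less_le_trans mult_less_cancel_right2 not_le of_nat_0_less_iff of_nat_le_iff)
    have "real (cnt A n) - real (cnt A ?k) \<le> c * ((1 - \<theta>) * real n)"
      using window[of n] True \<open>n > 0\<close> assms(2)
      by (simp add: window_ratio_eq[OF less_imp_le[OF assms(1)]] pos_divide_le_eq)
    also have "\<dots> \<le> c * (real n - real ?k)"
      using k(2) assms(3) by (intro mult_left_mono) (auto simp: algebra_simps)
    finally have 1: "real (cnt A n) - real (cnt A ?k) \<le> c * (real n - real ?k)" .
    have "(1 - \<theta>) * real ?k \<le> (1 - \<theta>) * real n"
      using \<open>?k < n\<close> assms(2) by (intro mult_left_mono) auto
    with 1 less.IH[OF \<open>?k < n\<close>] True show ?thesis
      by (simp add: algebra_simps)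
  next
    \<comment> \<open>The chain ends here and the trivial bound n - m suffices: it is at most N,
      respectively at most (1 - \<theta>) * n + 1.\<close>
    case False
    then have "n < N \<or> ?k \<le> m"
      by linarith
    then show ?thesis
    proof
      assume "n < N"
      then show ?thesis
        using triv pos by linarith
    next
      assume "?k \<le> m"
      then have "real n - real m \<le> (1 - \<theta>) * real n + 1"
        using k(3) by (simp add: algebra_simps)
      then show ?thesis
        using triv pos by linarith
    qed
  qed
qed

text \<open>For each e a single \<theta> with 1 - \<theta> < e is enough, since the last window of
  the chain then costs at most e * n up to a constant. So suitable \<theta> need only occur
  arbitrarily close to 1.\<close>

lemma increment_bound_if_upper_window_less:
  assumes "\<exists>\<^sub>F \<theta> in at_left 1. upper_window A \<theta> < ereal c"
  shows "increment_bound A c"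
  unfolding increment_bound_def
proof (intro allI impI)
  fix e :: real
  assume "e > 0"
  have "\<forall>\<^sub>F \<theta> in at_left 1. max 0 (1 - e) < \<theta> \<and> \<theta> < (1::real)"
    using \<open>e > 0\<close> by (auto simp: eventually_at_left_field intro!: exI[of _ "max 0 (1 - e)"])
  with assms have "\<exists>\<^sub>F \<theta> in at_left 1. upper_window A \<theta> < ereal c \<and> max 0 (1 - e) < \<theta> \<and> \<theta> < 1"
    by (rule frequently_eventually_frequently)
  then obtain \<theta> where \<theta>: "upper_window A \<theta> < ereal c" "0 < \<theta>" "1 - e < \<theta>" "\<theta> < 1"
    using frequently_ex by force
  obtain N where N: "\<And>n. n \<ge> N \<Longrightarrow> window_ratio A \<theta> n < c"
    using eventually_less_if_limsup_less[OF \<theta>(1)[unfolded upper_window_def]]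
    by (auto simp: eventually_sequentially)
  have "0 \<le> window_ratio A \<theta> N"
    unfolding window_ratio_eq[OF less_imp_le[OF \<theta>(2)]]
    using \<theta> cnt_mono[OF window_floor(1)[OF \<theta>(2,4), of N], of A]
    by (intro divide_nonneg_nonneg) auto
  with N[of N] have "0 \<le> c"
    by simp
  have "real (cnt A n) - real (cnt A m) \<le> c * (real n - real m) + e * real n + (real N + 1)"
    if "m \<le> n" for m n
  proof -
    have "(1 - \<theta>) * real n \<le> e * real n"
      using \<theta> by (intro mult_right_mono) auto
    then show ?thesis
      using increment_le_if_window_le[of \<theta> c N A m n] \<theta>(2,4) \<open>0 \<le> c\<close> N that
      by (fastforce intro: less_imp_le)
  qed
  then show "\<exists>K. \<forall>n. \<forall>m\<le>n. real (cnt A n) - real (cnt A m)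
      \<le> c * (real n - real m) + e * real n + K"
    by blast
qed

lemma upper_window_tendsto:
  assumes "A \<subseteq> posnats"
  shows "(upper_window A \<longlongrightarrow> upper_star A) (at_left 1)"
proof (rule tendsto_if_frequently_bound)
  have "upper_window A \<theta> \<le> upper_star A" if "0 < \<theta>" "\<theta> < 1" for \<theta>
    by (rule le_upper_star) (rule upper_window_le[OF _ that])
  then show "\<forall>\<^sub>F \<theta> in at_left 1. upper_window A \<theta> \<le> upper_star A"
    by (auto simp: eventually_at_left_field intro!: exI[of _ 0])
next
  fix c
  assume "\<exists>\<^sub>F \<theta> in at_left 1. upper_window A \<theta> < ereal c"
  then show "upper_star A \<le> ereal c"
    using upper_star_le[OF assms increment_bound_if_upper_window_less] by blast
qed

section \<open>Weighted sums and the growth of power sums\<close>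

lemma weighted_sum_0 [simp]: "weighted_sum \<alpha> A 0 = 0"
  by (simp add: weighted_sum_def)

lemma weighted_sum_Suc:
  "weighted_sum \<alpha> A (Suc n) = weighted_sum \<alpha> A n + (if Suc n \<in> A then real (Suc n) powr \<alpha> else 0)"
proof (cases "Suc n \<in> A")
  case True
  then have "A \<inter> {1..Suc n} = insert (Suc n) (A \<inter> {1..n})"
    by auto
  with True show ?thesis
    by (simp add: weighted_sum_def)
next
  case False
  then have "A \<inter> {1..Suc n} = A \<inter> {1..n}"
    by (auto simp: le_Suc_eq)
  with False show ?thesis
    by (simp add: weighted_sum_def)
qed

lemma weighted_sum_nonneg: "0 \<le> weighted_sum \<alpha> A n"
  by (simp add: weighted_sum_def sum_nonneg)

lemma weighted_sum_Un_disjoint: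
  "A \<inter> B = {} \<Longrightarrow> weighted_sum \<alpha> (A \<union> B) n = weighted_sum \<alpha> A n + weighted_sum \<alpha> B n"
  by (induction n) (auto simp: weighted_sum_Suc)

text \<open>Mean value theorem for the power \<alpha> + 1, whose derivative is increasing. The point
  x = 0 is treated apart because the derivative rule for \<open>powr\<close> asks for a positive
  base.\<close>

lemma powr_increment_bounds:
  fixes x \<alpha> :: real
  assumes "0 \<le> x" "0 < \<alpha>"
  shows "(\<alpha> + 1) * x powr \<alpha> \<le> (x + 1) powr (\<alpha> + 1) - x powr (\<alpha> + 1)"
    and "(x + 1) powr (\<alpha> + 1) - x powr (\<alpha> + 1) \<le> (\<alpha> + 1) * (x + 1) powr \<alpha>"
proof -
  have "(\<alpha> + 1) * x powr \<alpha> \<le> (x + 1) powr (\<alpha> + 1) - x powr (\<alpha> + 1) \<and>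
    (x + 1) powr (\<alpha> + 1) - x powr (\<alpha> + 1) \<le> (\<alpha> + 1) * (x + 1) powr \<alpha>"
  proof (cases "x = 0")
    case True
    then show ?thesis
      using assms by simp
  next
    case False
    have "\<exists>z>x. z < x + 1 \<and> (x + 1) powr (\<alpha> + 1) - x powr (\<alpha> + 1) = (x + 1 - x) * ((\<alpha> + 1) * z powr \<alpha>)"
      using False assms has_real_derivative_powr[of _ "\<alpha> + 1"] by (intro MVT2) auto
    then obtain z where z: "x < z" "z < x + 1"
      "(x + 1) powr (\<alpha> + 1) - x powr (\<alpha> + 1) = (\<alpha> + 1) * z powr \<alpha>"
      by auto
    then have "x powr \<alpha> \<le> z powr \<alpha>" "z powr \<alpha> \<le> (x + 1) powr \<alpha>"
      using assms by (auto intro!: powr_mono2)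
    with z(3) assms(2) show ?thesis
      by (simp add: mult_left_mono)
  qed
  then show "(\<alpha> + 1) * x powr \<alpha> \<le> (x + 1) powr (\<alpha> + 1) - x powr (\<alpha> + 1)"
    "(x + 1) powr (\<alpha> + 1) - x powr (\<alpha> + 1) \<le> (\<alpha> + 1) * (x + 1) powr \<alpha>"
    by auto
qed

text \<open>Telescoping \<open>powr_increment_bounds\<close> compares the power sum with the
  integrals of x powr \<alpha> over [0, n] and [0, n + 1].\<close>

lemma weighted_sum_posnats_bounds:
  assumes "0 < \<alpha>"
  shows "real n powr (\<alpha> + 1) \<le> (\<alpha> + 1) * weighted_sum \<alpha> posnats n"
    and "(\<alpha> + 1) * weighted_sum \<alpha> posnats n \<le> (real n + 1) powr (\<alpha> + 1)"
proof -
  have "real n powr (\<alpha> + 1) \<le> (\<alpha> + 1) * weighted_sum \<alpha> posnats n \<and>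
    (\<alpha> + 1) * weighted_sum \<alpha> posnats n \<le> (real n + 1) powr (\<alpha> + 1)"
  proof (induction n)
    case 0
    then show ?case by simp
  next
    case (Suc n)
    then show ?case
      using powr_increment_bounds(1)[OF _ assms, of "real n + 1"]
        powr_increment_bounds(2)[OF _ assms, of "real n"]
      by (simp add: weighted_sum_Suc algebra_simps)
  qed
  then show "real n powr (\<alpha> + 1) \<le> (\<alpha> + 1) * weighted_sum \<alpha> posnats n"
    and "(\<alpha> + 1) * weighted_sum \<alpha> posnats n \<le> (real n + 1) powr (\<alpha> + 1)"
    by auto
qed

lemma weighted_sum_posnats_pos:
  assumes "0 < \<alpha>" "0 < n"
  shows "0 < weighted_sum \<alpha> posnats n"
proof -
  have "0 < real n powr (\<alpha> + 1)"
    using assms(2) by simp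
  also have "\<dots> \<le> (\<alpha> + 1) * weighted_sum \<alpha> posnats n"
    by (rule weighted_sum_posnats_bounds(1)[OF assms(1)])
  finally show ?thesis
    using assms(1) by (simp add: zero_less_mult_iff)
qed

section \<open>Abel summation and weighted densities for large \<alpha>\<close>

text \<open>Summation by parts from the right end: W n - W m is f m * (D n - D m) plus the terms (f
  (k + 1) - f k) * (D n - D k) for m \<le> k < n, and each tail D n - D k is at most E.\<close>

lemma abel_increasing:
  fixes D W f :: "nat \<Rightarrow> real"
  assumes "\<And>k. W (Suc k) - W k = f (Suc k) * (D (Suc k) - D k)"
    and "\<And>k. f k \<le> f (Suc k)"
    and "\<And>m. m \<le> n \<Longrightarrow> D n - D m \<le> E"
  shows "m \<le> n \<Longrightarrow> W n - W m \<le> f m * (D n - D m) + E * (f n - f m)"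
proof (induction rule: inc_induct)
  case base
  then show ?case by simp
next
  case (step m)
  have "(f (Suc m) - f m) * (D n - D m) \<le> (f (Suc m) - f m) * E"
    using assms(2)[of m] assms(3)[of m] step.hyps by (intro mult_left_mono) auto
  with step.IH assms(1)[of m] show ?case
    by (simp add: algebra_simps)
qed

text \<open>With V = K - W \<ge> 0, summation by parts leaves the right-hand side plus the terms (a
  (k + 1) - a k) * V k \<le> 0 for m < k < n. Monotonicity of \<open>a\<close> starts at index 1,
  since \<open>0 powr - \<alpha>\<close> is 0 in HOL.\<close>

lemma abel_decreasing:
  fixes D W a :: "nat \<Rightarrow> real"
  assumes "\<And>k. D (Suc k) - D k = a (Suc k) * (W (Suc k) - W k)"
    and "\<And>k. a (Suc (Suc k)) \<le> a (Suc k)"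
    and "\<And>k. W k \<le> K"
  shows "Suc m \<le> n \<Longrightarrow> D n - D m \<le> a (Suc m) * (K - W m) - a n * (K - W n)"
proof (induction rule: dec_induct)
  case base
  show ?case
    using assms(1)[of m] by (simp add: algebra_simps)
next
  case (step n)
  obtain k where k: "n = Suc k"
    using step.hyps by (cases n) auto
  have "a (Suc n) * (K - W n) \<le> a n * (K - W n)"
    using assms(2)[of k] assms(3)[of n] k by (intro mult_right_mono) auto
  with step.IH assms(1)[of n] show ?case
    by (simp add: algebra_simps)
qed

text \<open>Abel summation bounds the weighted excess of \<open>A\<close> over c by E * n powr
  \<alpha>, and n powr \<alpha> is at most (\<alpha> + 1) / n times the total weight. The choice e /
  (\<alpha> + 1) cancels that factor.\<close>

lemma upper_weighted_le:
  assumes "increment_bound A c" "0 < \<alpha>"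
  shows "upper_weighted A \<alpha> \<le> ereal c"
  unfolding upper_weighted_def
proof (rule limsup_le_if_bound)
  fix e :: real
  assume "0 < e"
  then have "0 < e / (\<alpha> + 1)"
    using assms by simp
  then obtain K where K: "\<And>n m. m \<le> n \<Longrightarrow> real (cnt A n) - real (cnt A m)
      \<le> c * (real n - real m) + e / (\<alpha> + 1) * real n + K"
    using assms(1) unfolding increment_bound_def by blast
  have "0 \<le> K"
    using K[of 0 0] by simp
  have "weighted_sum \<alpha> A n / weighted_sum \<alpha> posnats n \<le> c + e + (K * (\<alpha> + 1)) / real n"
    if "n > 0" for n
  proof -
    define V where "V = weighted_sum \<alpha> posnats n"
    define E where "E = e / (\<alpha> + 1) * real n + K"
    have "0 < V"
      unfolding V_def by (rule weighted_sum_posnats_pos[OF assms(2) that])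
    have "0 \<le> E"
      using \<open>0 < e\<close> \<open>0 \<le> K\<close> assms(2) by (simp add: E_def)
    let ?W = "\<lambda>n. weighted_sum \<alpha> A n - c * weighted_sum \<alpha> posnats n"
    \<comment> \<open>Starting at 0 removes the boundary term, because
      \<open>0 powr \<alpha>\<close> is 0.\<close>
    have "?W n - ?W 0 \<le> real 0 powr \<alpha> * ((real (cnt A n) - c * real n) - (real (cnt A 0) - c * real 0))
        + E * (real n powr \<alpha> - real 0 powr \<alpha>)"
    proof (rule abel_increasing)
      show "real (cnt A n) - c * real n - (real (cnt A m) - c * real m) \<le> E" if "m \<le> n" for m
        using K[OF that] by (simp add: E_def algebra_simps)
    qed (auto simp: weighted_sum_Suc cnt_Suc algebra_simps intro!: powr_mono2 less_imp_le[OF assms(2)])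
    then have "weighted_sum \<alpha> A n \<le> c * V + E * real n powr \<alpha>"
      by (simp add: V_def)
    also have "real n powr \<alpha> \<le> (\<alpha> + 1) * V / real n"
      using weighted_sum_posnats_bounds(1)[OF assms(2), of n] that
      by (simp add: V_def powr_add field_simps)
    finally have "weighted_sum \<alpha> A n \<le> c * V + E * ((\<alpha> + 1) * V / real n)"
      using \<open>0 \<le> E\<close> by (simp add: mult_left_mono)
    also have "\<dots> = (c + E * (\<alpha> + 1) / real n) * V"
      by (simp add: algebra_simps)
    also have "E * (\<alpha> + 1) = e * real n + K * (\<alpha> + 1)"
      using assms(2) by (simp add: E_def distrib_right)
    also have "(e * real n + K * (\<alpha> + 1)) / real n = e + (K * (\<alpha> + 1)) / real n"
      using that by (simp add: add_divide_distrib)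
    finally show ?thesis
      unfolding V_def[symmetric] using \<open>0 < V\<close> by (simp add: pos_divide_le_eq add.assoc)
  qed
  then have "\<forall>\<^sub>F n in sequentially. weighted_sum \<alpha> A n / weighted_sum \<alpha> posnats n
      \<le> c + e + (K * (\<alpha> + 1)) / real n"
    by (rule eventually_mono[OF eventually_gt_at_top[of "0::nat"]])
  then show "\<exists>K. \<forall>\<^sub>F n in sequentially. weighted_sum \<alpha> A n / weighted_sum \<alpha> posnats n
      \<le> c + e + K / real n"
    by blast
qed

text \<open>Abel summation with the weights k powr -\<alpha> recovers the plain count. The boundary
  term at m compares the power sum up to m with (m + 1) powr \<alpha>; this quotient is at most (m +
  1) / (\<alpha> + 1), hence small relative to m for large \<alpha>.\<close>

lemma increment_le_if_weighted_sum_le: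
  assumes "0 < \<alpha>" "0 \<le> c" "0 \<le> K"
    and W: "\<And>n. weighted_sum \<alpha> A n \<le> c * weighted_sum \<alpha> posnats n + K"
    and "m < n"
  shows "real (cnt A n) - real (cnt A m)
    \<le> c * (real n - real m) + c / (\<alpha> + 1) * (real m + 1) + K"
proof -
  define p where "p = (real m + 1) powr - \<alpha>"
  define W where "W n = weighted_sum \<alpha> A n - c * weighted_sum \<alpha> posnats n" for n
  have "0 \<le> p" "p \<le> 1"
    using assms(1) powr_mono2'[of "-\<alpha>" 1 "real m + 1"] by (auto simp: p_def)
  have cancel: "(1 + real k) powr - \<alpha> * (1 + real k) powr \<alpha> = 1" for k
    by (simp flip: powr_add)
  have "(real (cnt A n) - c * real n) - (real (cnt A m) - c * real m)
      \<le> real (Suc m) powr - \<alpha> * (K - W m) - real n powr - \<alpha> * (K - W n)"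
  proof (rule abel_decreasing)
    show "real (cnt A (Suc k)) - c * real (Suc k) - (real (cnt A k) - c * real k)
        = real (Suc k) powr - \<alpha> * (W (Suc k) - W k)" for k
      using cancel[of k] by (auto simp: W_def weighted_sum_Suc cnt_Suc algebra_simps)
    show "real (Suc (Suc k)) powr - \<alpha> \<le> real (Suc k) powr - \<alpha>" for k
      using assms(1) by (intro powr_mono2') auto
    show "W k \<le> K" for k
      using W[of k] by (simp add: W_def)
    show "Suc m \<le> n"
      using assms(5) by simp
  qed
  moreover have "0 \<le> real n powr - \<alpha> * (K - W n)"
    using W[of n] by (simp add: W_def)
  moreover have "real (Suc m) powr - \<alpha> = p"
    by (simp add: p_def add.commute)
  ultimately have "(real (cnt A n) - c * real n) - (real (cnt A m) - c * real m) \<le> p * (K - W m)"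
    by simp
  also have "\<dots> \<le> p * (K + c * weighted_sum \<alpha> posnats m)"
    using \<open>0 \<le> p\<close> weighted_sum_nonneg[of \<alpha> A m] by (intro mult_left_mono) (auto simp: W_def)
  also have "\<dots> \<le> K + c * (p * weighted_sum \<alpha> posnats m)"
    using mult_right_mono[OF \<open>p \<le> 1\<close> assms(3)] by (simp add: algebra_simps)
  finally have *: "(real (cnt A n) - c * real n) - (real (cnt A m) - c * real m)
    \<le> K + c * (p * weighted_sum \<alpha> posnats m)" .
  have "p * weighted_sum \<alpha> posnats m \<le> p * ((real m + 1) powr (\<alpha> + 1) / (\<alpha> + 1))"
    using weighted_sum_posnats_bounds(2)[OF assms(1), of m] assms(1) \<open>0 \<le> p\<close>
    by (intro mult_left_mono) (auto simp: pos_le_divide_eq mult.commute)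
  also have "\<dots> = (real m + 1) / (\<alpha> + 1)"
    by (simp add: p_def flip: powr_add)
  finally have "c * (p * weighted_sum \<alpha> posnats m) \<le> c * ((real m + 1) / (\<alpha> + 1))"
    using assms(2) by (rule mult_left_mono)
  with * show ?thesis
    by (simp add: algebra_simps)
qed

text \<open>For each e one positive \<alpha> \<ge> c / e suffices, because then c / (\<alpha> + 1)
  \<le> e. So suitable \<alpha> need only occur arbitrarily far out.\<close>

lemma increment_bound_if_upper_weighted_less:
  assumes "\<exists>\<^sub>F \<alpha> in at_top. upper_weighted A \<alpha> < ereal c"
  shows "increment_bound A c"
  unfolding increment_bound_def
proof (intro allI impI)
  fix e :: real
  assume "e > 0"
  have "\<forall>\<^sub>F \<alpha> in at_top. 0 < \<alpha> \<and> c / e \<le> (\<alpha>::real)"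
    by (intro eventually_conj eventually_gt_at_top eventually_ge_at_top)
  with assms have "\<exists>\<^sub>F \<alpha> in at_top. upper_weighted A \<alpha> < ereal c \<and> 0 < \<alpha> \<and> c / e \<le> \<alpha>"
    by (rule frequently_eventually_frequently)
  then obtain \<alpha> where \<alpha>: "upper_weighted A \<alpha> < ereal c" "0 < \<alpha>" "c / e \<le> \<alpha>"
    using frequently_ex by force
  obtain N where N: "\<And>n. n \<ge> N \<Longrightarrow> weighted_sum \<alpha> A n / weighted_sum \<alpha> posnats n < c"
    using eventually_less_if_limsup_less[OF \<alpha>(1)[unfolded upper_weighted_def]]
    by (auto simp: eventually_sequentially)
  have "0 \<le> weighted_sum \<alpha> A N / weighted_sum \<alpha> posnats N"
    by (simp add: weighted_sum_nonneg)
  with N[of N] have "0 \<le> c"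
    by simp
  \<comment> \<open>A crude common bound for the finitely many weighted sums below the
    threshold.\<close>
  define K where "K = (\<Sum>k<N. weighted_sum \<alpha> A k)"
  have "0 \<le> K"
    by (simp add: K_def sum_nonneg weighted_sum_nonneg)
  have W: "weighted_sum \<alpha> A n \<le> c * weighted_sum \<alpha> posnats n + K" for n
  proof (cases "n < N")
    case True
    then have "weighted_sum \<alpha> A n \<le> K"
      unfolding K_def by (intro member_le_sum) (auto simp: weighted_sum_nonneg)
    moreover have "0 \<le> c * weighted_sum \<alpha> posnats n"
      using \<open>0 \<le> c\<close> by (simp add: weighted_sum_nonneg)
    ultimately show ?thesis
      by linarith
  next
    case False
    show ?thesis
    proof (cases "n = 0")
      case True
      then show ?thesis
        using \<open>0 \<le> K\<close> by simp
    next
      case False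
      then have "weighted_sum \<alpha> A n < c * weighted_sum \<alpha> posnats n"
        using N[of n] \<open>\<not> n < N\<close> weighted_sum_posnats_pos[OF \<alpha>(2), of n]
        by (simp add: pos_divide_less_eq)
      then show ?thesis
        using \<open>0 \<le> K\<close> by simp
    qed
  qed
  have "real (cnt A n) - real (cnt A m) \<le> c * (real n - real m) + e * real n + (e + K)"
    if "m \<le> n" for m n
  proof (cases "m = n")
    case True
    then show ?thesis
      using \<open>0 < e\<close> \<open>0 \<le> K\<close> by simp
  next
    case False
    have "c / (\<alpha> + 1) \<le> e"
      using \<alpha> \<open>0 < e\<close> by (simp add: field_simps)
    then have "c / (\<alpha> + 1) * (real m + 1) \<le> e * (real n + 1)"
      using \<open>0 < e\<close> that by (intro mult_mono) auto
    then show ?thesis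
      using increment_le_if_weighted_sum_le[OF \<alpha>(2) \<open>0 \<le> c\<close> \<open>0 \<le> K\<close> W, of m n] that False
      by (simp add: algebra_simps)
  qed
  then show "\<exists>K. \<forall>n. \<forall>m\<le>n. real (cnt A n) - real (cnt A m)
      \<le> c * (real n - real m) + e * real n + K"
    by blast
qed

lemma upper_weighted_tendsto:
  assumes "A \<subseteq> posnats"
  shows "(upper_weighted A \<longlongrightarrow> upper_star A) at_top"
proof (rule tendsto_if_frequently_bound)
  have "upper_weighted A \<alpha> \<le> upper_star A" if "0 < \<alpha>" for \<alpha>
    by (rule le_upper_star) (rule upper_weighted_le[OF _ that])
  then show "\<forall>\<^sub>F \<alpha> in at_top. upper_weighted A \<alpha> \<le> upper_star A"
    by (rule eventually_mono[OF eventually_gt_at_top[of 0]])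
next
  fix c
  assume "\<exists>\<^sub>F \<alpha> in at_top. upper_weighted A \<alpha> < ereal c"
  then show "upper_star A \<le> ereal c"
    using upper_star_le[OF assms increment_bound_if_upper_weighted_less] by blast
qed

section \<open>Density measures as limits of window averages\<close>

text \<open>By Tychonoff's theorem the cube of all functions into the unit interval is compact; the filter
  \<open>G\<close> plays the role of an ultrafilter limit.\<close>

lemma pointwise_convergent_subfilter:
  fixes \<nu> :: "nat \<Rightarrow> 'a \<Rightarrow> real"
  assumes "\<And>i x. \<nu> i x \<in> {0..1}"
  obtains G \<mu> where "G \<noteq> bot" "G \<le> sequentially" "\<And>x. ((\<lambda>i. \<nu> i x) \<longlongrightarrow> \<mu> x) G"
proof -
  have "compactin (product_topology (\<lambda>x::'a. euclidean :: real topology) UNIV) (PiE UNIV (\<lambda>_. {0..1}))"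
    unfolding compactin_PiE by simp
  then have "compact (PiE UNIV (\<lambda>_. {0..1}) :: ('a \<Rightarrow> real) set)"
    by (simp add: euclidean_product_topology)
  moreover have "filtermap \<nu> sequentially \<noteq> bot"
    by (simp add: filtermap_bot_iff)
  moreover have "\<forall>\<^sub>F f in filtermap \<nu> sequentially. f \<in> PiE UNIV (\<lambda>_. {0..1})"
    using assms by (simp add: eventually_filtermap PiE_iff)
  ultimately obtain \<mu> where \<mu>: "inf (nhds \<mu>) (filtermap \<nu> sequentially) \<noteq> bot"
    unfolding compact_filter by blast
  \<comment> \<open>Pulling the neighbourhoods of the cluster point back to the indices gives a
    filter along which \<nu> itself converges; it is proper because \<mu> is a cluster
    point.\<close>
  define G where "G = inf (filtercomap \<nu> (nhds \<mu>)) sequentially"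
  have "G \<noteq> bot"
  proof
    assume "G = bot"
    then have "\<forall>\<^sub>F i in G. False"
      by simp
    then obtain P Q where PQ: "eventually P (filtercomap \<nu> (nhds \<mu>))" "eventually Q sequentially"
      "\<And>i. P i \<Longrightarrow> Q i \<Longrightarrow> False"
      unfolding G_def eventually_inf by blast
    then obtain R where R: "eventually R (nhds \<mu>)" "\<And>i. R (\<nu> i) \<Longrightarrow> P i"
      unfolding eventually_filtercomap by blast
    have "\<forall>\<^sub>F f in filtermap \<nu> sequentially. \<not> R f"
      unfolding eventually_filtermap using PQ(2) by (rule eventually_mono) (use PQ(3) R(2) in blast)
    with R(1) have "\<forall>\<^sub>F f in inf (nhds \<mu>) (filtermap \<nu> sequentially). False"
      unfolding eventually_inf by blast
    with \<mu> show False
      by (simp add: trivial_limit_def)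
  qed
  moreover have "G \<le> sequentially"
    by (simp add: G_def)
  moreover have "((\<lambda>i. \<nu> i x) \<longlongrightarrow> \<mu> x) G" for x
  proof -
    have "(\<nu> \<longlongrightarrow> \<mu>) G"
      unfolding G_def by (rule filterlim_mono[OF filterlim_filtercomap order_refl inf_le1])
    then show ?thesis
      by (rule continuous_on_tendsto_compose[OF continuous_on_product_coordinates]) auto
  qed
  ultimately show thesis
    using that by blast
qed

text \<open>If the bound fails, there are windows \<open>(M i, N i]\<close> of length at least a fixed fraction of
  \<open>N i\<close> on which \<open>A\<close> has average above \<open>c\<close>; a cluster point of these window averages is the
  desired measure.\<close>

lemma density_measure_of_not_increment_bound:
  assumes "\<not> increment_bound A c" "0 \<le> c" "A \<subseteq> posnats"
  obtains \<mu> where "\<mu> \<in> density_measures" "c \<le> \<mu> A"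
proof -
  obtain e where "e > 0" and e: "\<And>K. \<exists>n m. m \<le> n \<and>
      c * (real n - real m) + e * real n + K < real (cnt A n) - real (cnt A m)"
    using assms(1) unfolding increment_bound_def by (meson not_le)
  \<comment> \<open>The constant i + 1 forces the window length above i, and the e-term forces it
    above e * N i. Both make the averages of a set with density d tend to d.\<close>
  have "\<exists>n m. m \<le> n \<and> c * (real n - real m) + e * real n + (real i + 1) < real (cnt A n) - real (cnt A m)"
    for i
    using e by blast
  then obtain N M where MN: "\<And>i. M i \<le> N i"
    "\<And>i. c * (real (N i) - real (M i)) + e * real (N i) + (real i + 1)
      < real (cnt A (N i)) - real (cnt A (M i))"
    by metis
  define len where "len i = real (N i) - real (M i)" for i
  define \<nu> where "\<nu> i B = (real (cnt B (N i)) - real (cnt B (M i))) / len i" for i B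
  have len: "e * real (N i) < len i" "real i < len i" "0 < len i" for i
  proof -
    have "0 \<le> c * len i" "0 \<le> e * real (N i)"
      using MN(1)[of i] assms(2) \<open>e > 0\<close> by (auto simp: len_def)
    then show "e * real (N i) < len i" "real i < len i" "0 < len i"
      using MN(2)[of i] cnt_increment_le[OF MN(1), of A i] unfolding len_def by linarith+
  qed
  have "\<nu> i B \<in> {0..1}" for i B
    using len(3)[of i] cnt_increment_le[OF MN(1), of B i] cnt_mono[OF MN(1), of B i]
    by (simp add: \<nu>_def len_def)
  then obtain G \<mu> where G: "G \<noteq> bot" "G \<le> sequentially" "\<And>B. ((\<lambda>i. \<nu> i B) \<longlongrightarrow> \<mu> B) G"
    using pointwise_convergent_subfilter[of \<nu>] by blast
  have "\<mu> B \<in> {0..1}" for B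
    using tendsto_lowerbound[OF G(3) _ G(1), of 0 B] tendsto_upperbound[OF G(3) _ G(1), of B 1]
      \<open>\<And>i B. \<nu> i B \<in> {0..1}\<close> by auto
  moreover have "\<mu> (B \<union> C) = \<mu> B + \<mu> C" if "B \<inter> C = {}" for B C
  proof -
    have "\<nu> i (B \<union> C) = \<nu> i B + \<nu> i C" for i
      by (simp add: \<nu>_def cnt_Un_disjoint[OF that] diff_divide_distrib add_divide_distrib)
    then show ?thesis
      using tendsto_unique[OF G(1,3), of "B \<union> C" "\<mu> B + \<mu> C"] tendsto_add[OF G(3) G(3), of B C]
      by simp
  qed
  moreover have "\<mu> B = asymp_density B" if B: "B \<in> has_asymp_density" for B
  proof -
    define d where "d = asymp_density B"
    have "(\<lambda>i. \<nu> i B) \<longlonglongrightarrow> d"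
    proof (rule LIMSEQ_I)
      fix r :: real
      assume "0 < r"
      \<comment> \<open>Each endpoint contributes less than r / 4 * len i through this error, and 2
        * K stays below r / 2 * len i; together this is below r * len i.\<close>
      then have "0 < r * e / 4"
        using \<open>e > 0\<close> by simp
      then obtain K where K: "\<And>n. \<bar>real (cnt B n) - d * real n\<bar> \<le> r * e / 4 * real n + K"
        using density_seq_tendstoD[OF has_asymp_densityD[OF B]] unfolding d_def by blast
      have "norm (\<nu> i B - d) < r" if i: "i \<ge> Suc (nat \<lceil>4 * K / r\<rceil>)" for i
      proof -
        have "4 * K / r < real i"
          using i by linarith
        then have "4 * K / r < len i"
          using len(2)[of i] by linarith
        then have "4 * K < r * len i"
          using \<open>0 < r\<close> by (simp add: field_simps)
        have "r / 4 * (e * real (N i)) < r / 4 * len i"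
          using len(1)[of i] \<open>0 < r\<close> by (intro mult_strict_left_mono) auto
        moreover have "r * e / 4 * real (M i) \<le> r * e / 4 * real (N i)"
          using MN(1)[of i] \<open>0 < r * e / 4\<close> by (intro mult_left_mono) auto
        moreover have "real (cnt B (N i)) - real (cnt B (M i)) - d * len i
            = (real (cnt B (N i)) - d * real (N i)) - (real (cnt B (M i)) - d * real (M i))"
          by (simp add: len_def algebra_simps)
        ultimately have "\<bar>real (cnt B (N i)) - real (cnt B (M i)) - d * len i\<bar> < r * len i"
          using K[of "N i"] K[of "M i"] \<open>4 * K < r * len i\<close> by (simp add: abs_le_iff abs_less_iff)
        moreover have "\<nu> i B - d = (real (cnt B (N i)) - real (cnt B (M i)) - d * len i) / len i"
          using len(3)[of i] by (simp add: \<nu>_def diff_divide_distrib)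
        ultimately show ?thesis
          using len(3)[of i] by (simp add: abs_divide pos_divide_less_eq)
      qed
      then show "\<exists>no. \<forall>n\<ge>no. norm (\<nu> n B - d) < r"
        by blast
    qed
    then show ?thesis
      using tendsto_unique[OF G(1,3)] tendsto_mono[OF G(2)] d_def by blast
  qed
  ultimately have "\<mu> \<in> density_measures"
    by (auto simp: density_measures_def additive_def)
  moreover have "c \<le> \<nu> i A" for i
  proof -
    have "c * len i \<le> real (cnt A (N i)) - real (cnt A (M i))"
      using MN(2)[of i] \<open>e > 0\<close> mult_nonneg_nonneg[of e "real (N i)"] unfolding len_def by linarith
    then show ?thesis
      using len(3)[of i] by (simp add: \<nu>_def pos_le_divide_eq)
  qed
  then have "c \<le> \<mu> A"
    using tendsto_lowerbound[OF G(3) _ G(1)] by simp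
  ultimately show thesis
    using that by blast
qed

text \<open>The window construction applies to \<open>posnats\<close> with c = 0. Nonemptiness keeps
  the supremum over density measures from being minus infinity and lets subtraction from 1 pass
  through it.\<close>

lemma density_measures_nonempty: "density_measures \<noteq> {}"
proof -
  have "\<not> increment_bound posnats 0"
  proof
    assume "increment_bound posnats 0"
    then obtain K where "\<And>n m. m \<le> n \<Longrightarrow>
        real (cnt posnats n) - real (cnt posnats m) \<le> 0 * (real n - real m) + 1 / 2 * real n + K"
      unfolding increment_bound_def by (metis half_gt_zero zero_less_one)
    from this[of 0] have K: "real n \<le> 2 * K" for n
      unfolding cnt_posnats by (simp add: field_simps)
    obtain n where "2 * K < real n"
      using reals_Archimedean2 by blast
    with K[of n] show False
      by simp
  qed
  then show ?thesis
    using density_measure_of_not_increment_bound[of posnats 0] by auto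
qed

lemma density_measure_Un:
  assumes "\<mu> \<in> density_measures" "A \<subseteq> posnats" "B \<subseteq> posnats" "A \<inter> B = {}"
  shows "\<mu> (A \<union> B) = \<mu> A + \<mu> B"
proof -
  have "additive (Pow posnats) \<mu>"
    using assms(1) by (simp add: density_measures_def)
  then show ?thesis
    using assms(2-4) unfolding additive_def by blast
qed

lemma density_measure_mono:
  assumes "\<mu> \<in> density_measures" "A \<subseteq> B" "B \<subseteq> posnats"
  shows "\<mu> A \<le> \<mu> B"
proof -
  have "\<mu> (A \<union> (B - A)) = \<mu> A + \<mu> (B - A)"
    by (rule density_measure_Un) (use assms in auto)
  moreover have "0 \<le> \<mu> (B - A)"
    using assms by (fastforce simp: density_measures_def)
  moreover have "A \<union> (B - A) = B"
    using assms by auto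
  ultimately show ?thesis
    by simp
qed

text \<open>One inequality is monotonicity of density measures. For the other, a c strictly between
  the two values fails the increment bound, and the resulting measure gives \<open>A\<close> mass at
  least c.\<close>

lemma upper_dm_eq_upper_star:
  assumes "A \<subseteq> posnats"
  shows "upper_dm A = upper_star A"
proof (rule antisym)
  show "upper_dm A \<le> upper_star A"
    unfolding upper_dm_def upper_star_def
  proof (intro SUP_least INF_greatest)
    fix \<mu> B
    assume "\<mu> \<in> density_measures" "B \<in> {B \<in> has_asymp_density. A \<subseteq> B}"
    then show "ereal (\<mu> A) \<le> ereal (asymp_density B)"
      using density_measure_mono[of \<mu> A B] by (simp add: density_measures_def has_asymp_density_def)
  qed
  \<comment> \<open>Ensures that the separating c below is nonnegative, as the measure construction
    requires.\<close>
  have nonneg: "0 \<le> upper_dm A"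
  proof -
    obtain \<mu> where "\<mu> \<in> density_measures"
      using density_measures_nonempty by blast
    moreover from this have "0 \<le> \<mu> A"
      using assms by (auto simp: density_measures_def)
    ultimately show ?thesis
      unfolding upper_dm_def by (intro SUP_upper2) auto
  qed
  show "upper_star A \<le> upper_dm A"
  proof (rule ccontr)
    assume "\<not> ?thesis"
    then obtain c where c: "upper_dm A < ereal c" "ereal c < upper_star A"
      using ereal_dense2 by (metis not_le)
    have "0 \<le> c"
      using nonneg c(1) by (metis ereal_less_eq(5) less_imp_le order_trans)
    moreover have "\<not> increment_bound A c"
      using upper_star_le[OF assms] c(2) by (metis not_le)
    ultimately obtain \<mu> where "\<mu> \<in> density_measures" "c \<le> \<mu> A"
      using density_measure_of_not_increment_bound assms by blast
    then have "ereal c \<le> upper_dm A"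
      unfolding upper_dm_def by (intro SUP_upper2) auto
    with c(1) show False
      by simp
  qed
qed

section \<open>Lower densities through complements\<close>

lemma density_measure_Compl:
  assumes "\<mu> \<in> density_measures" "A \<subseteq> posnats"
  shows "\<mu> A = 1 - \<mu> (posnats - A)"
proof -
  have "\<mu> (A \<union> (posnats - A)) = \<mu> A + \<mu> (posnats - A)"
    by (rule density_measure_Un) (use assms in auto)
  moreover have "A \<union> (posnats - A) = posnats"
    using assms(2) by auto
  moreover have "\<mu> posnats = 1"
    using assms(1) posnats_density by (simp add: density_measures_def)
  ultimately show ?thesis
    by simp
qed

lemma lower_dm_Compl:
  assumes "A \<subseteq> posnats"
  shows "lower_dm A = 1 - upper_dm (posnats - A)"
proof -
  have "lower_dm A = (INF \<mu> \<in> density_measures. 1 - ereal (\<mu> (posnats - A)))"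
    unfolding lower_dm_def using density_measure_Compl[OF _ assms]
    by (intro INF_cong) (auto simp: one_ereal_def)
  also have "\<dots> = 1 - upper_dm (posnats - A)"
    unfolding upper_dm_def using density_measures_nonempty by (intro INF_ereal_minus_right) auto
  finally show ?thesis .
qed

lemma cnt_Compl:
  assumes "A \<subseteq> posnats"
  shows "real (cnt A n) = real n - real (cnt (posnats - A) n)"
proof -
  have "A \<union> (posnats - A) = posnats"
    using assms by auto
  then show ?thesis
    using cnt_Un_disjoint[of A "posnats - A" n] cnt_posnats[of n] by simp
qed

lemma asymp_density_Compl:
  assumes "B \<in> has_asymp_density"
  shows "posnats - B \<in> has_asymp_density" "asymp_density (posnats - B) = 1 - asymp_density B"
proof -
  have "density_seq (posnats - B) \<longlonglongrightarrow> 1 - asymp_density B"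
  proof (rule Lim_transform_eventually)
    show "(\<lambda>n. 1 - density_seq B n) \<longlonglongrightarrow> 1 - asymp_density B"
      by (intro tendsto_intros has_asymp_densityD assms)
    \<comment> \<open>At n = 0 both quotients are 0 / 0 = 0, so the identity holds only for positive
      n.\<close>
    have "1 - density_seq B n = density_seq (posnats - B) n" if "n > 0" for n
      using cnt_Compl[of B n] assms that
      by (simp add: density_seq_eq has_asymp_density_def field_simps)
    then show "\<forall>\<^sub>F n in sequentially. 1 - density_seq B n = density_seq (posnats - B) n"
      by (rule eventually_mono[OF eventually_gt_at_top[of "0::nat"]])
  qed
  then show "posnats - B \<in> has_asymp_density" "asymp_density (posnats - B) = 1 - asymp_density B"
    using has_asymp_densityI[OF Diff_subset] by auto
qed

text \<open>Complementation maps the competitors for the upper density of the complement onto those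
  for the lower density of \<open>A\<close>.\<close>

lemma lower_star_Compl:
  assumes "A \<subseteq> posnats"
  shows "lower_star A = 1 - upper_star (posnats - A)"
proof -
  let ?S = "{B \<in> has_asymp_density. posnats - A \<subseteq> B}"
  have "{B \<in> has_asymp_density. B \<subseteq> A} = (\<lambda>B. posnats - B) ` ?S" (is "?L = ?R")
  proof (intro set_eqI iffI)
    fix B
    assume "B \<in> ?L"
    then have "posnats - B \<in> ?S" "B = posnats - (posnats - B)"
      using asymp_density_Compl(1) by (auto simp: has_asymp_density_def)
    then show "B \<in> ?R"
      by (metis imageI)
  qed (use assms asymp_density_Compl(1) in auto)
  then have "lower_star A = (SUP B \<in> ?S. ereal (asymp_density (posnats - B)))"
    unfolding lower_star_def by (simp only: image_image)
  also have "\<dots> = (SUP B \<in> ?S. 1 - ereal (asymp_density B))"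
    by (rule SUP_cong) (use asymp_density_Compl(2) in \<open>auto simp: one_ereal_def\<close>)
  also have "\<dots> = 1 - upper_star (posnats - A)"
    unfolding upper_star_def using posnats_density(1) by (intro SUP_ereal_minus_right) auto
  finally show ?thesis .
qed

lemma lower_weighted_Compl:
  assumes "A \<subseteq> posnats" "0 < \<alpha>"
  shows "lower_weighted A \<alpha> = 1 - upper_weighted (posnats - A) \<alpha>"
proof -
  let ?r = "\<lambda>A n. weighted_sum \<alpha> A n / weighted_sum \<alpha> posnats n"
  have "A \<union> (posnats - A) = posnats"
    using assms by auto
  then have sum: "weighted_sum \<alpha> posnats n = weighted_sum \<alpha> A n + weighted_sum \<alpha> (posnats - A) n" for n
    using weighted_sum_Un_disjoint[of A "posnats - A" \<alpha> n] by simp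
  have "ereal (?r A n) = 1 - ereal (?r (posnats - A) n)" if "n > 0" for n
    using weighted_sum_posnats_pos[OF assms(2) that]
    unfolding one_ereal_def using sum[of n] by (simp add: field_simps del: One_nat_def)
  then have "\<forall>\<^sub>F n in sequentially. ereal (?r A n) = 1 - ereal (?r (posnats - A) n)"
    by (rule eventually_mono[OF eventually_gt_at_top[of "0::nat"]])
  then have "lower_weighted A \<alpha> = liminf (\<lambda>n. 1 - ereal (?r (posnats - A) n))"
    unfolding lower_weighted_def by (rule Liminf_eq)
  also have "\<dots> = 1 - upper_weighted (posnats - A) \<alpha>"
    unfolding upper_weighted_def by (rule liminf_ereal_cminus) simp
  finally show ?thesis .
qed

text \<open>The ratios of \<open>A\<close> and its complement add up to u n, the window ratio of
  \<open>posnats\<close>. Rounding can make it exceed 1, but it tends to 1, which suffices in the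
  limit.\<close>

lemma lower_window_Compl:
  assumes "A \<subseteq> posnats" "0 < \<theta>" "\<theta> < 1"
  shows "lower_window A \<theta> = 1 - upper_window (posnats - A) \<theta>"
proof -
  define u where "u n = (real n - real (nat \<lfloor>\<theta> * real n\<rfloor>)) / ((1 - \<theta>) * real n)" for n
  have split: "window_ratio A \<theta> n = u n - window_ratio (posnats - A) \<theta> n" for n
    using assms(2)
    by (simp add: window_ratio_eq u_def cnt_Compl[OF assms(1)] flip: diff_divide_distrib)
  have "u \<longlonglongrightarrow> 1"
  proof (rule tendsto_sandwich)
    have u: "1 \<le> u n \<and> u n \<le> 1 + 1 / (1 - \<theta>) / real n" if "n > 0" for n
    proof -
      define w where "w = (1 - \<theta>) * real n"
      define l where "l = real n - real (nat \<lfloor>\<theta> * real n\<rfloor>)"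
      have "0 < w"
        using assms that by (simp add: w_def)
      have "w \<le> l" "l \<le> w + 1"
        using window_floor(2,3)[OF assms(2,3), of n] by (simp_all add: w_def l_def algebra_simps)
      then have "1 \<le> l / w" "l / w \<le> (w + 1) / w"
        using \<open>0 < w\<close> by (simp_all add: pos_le_divide_eq divide_right_mono)
      moreover have "(w + 1) / w = 1 + 1 / (1 - \<theta>) / real n"
        using \<open>0 < w\<close> assms(3) that by (simp add: add_divide_distrib w_def)
      ultimately show ?thesis
        by (simp add: u_def w_def l_def)
    qed
    show "\<forall>\<^sub>F n in sequentially. 1 \<le> u n"
      "\<forall>\<^sub>F n in sequentially. u n \<le> 1 + 1 / (1 - \<theta>) / real n"
      by (rule eventually_mono[OF eventually_gt_at_top[of "0::nat"]], use u in blast)+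
    show "(\<lambda>n. 1 + 1 / (1 - \<theta>) / real n) \<longlonglongrightarrow> 1"
      using tendsto_add[OF tendsto_const lim_const_over_n[of "1 / (1 - \<theta>)"], of 1] by simp
  qed auto
  then have "(\<lambda>n. ereal (u n)) \<longlonglongrightarrow> 1"
    by (simp add: one_ereal_def)
  then have "liminf (\<lambda>n. ereal (u n) + - ereal (window_ratio (posnats - A) \<theta> n))
      = 1 + liminf (\<lambda>n. - ereal (window_ratio (posnats - A) \<theta> n))"
    by (rule ereal_liminf_lim_add) auto
  then show ?thesis
    unfolding lower_window_def upper_window_def split ereal_Liminf_uminus
    by (simp add: minus_ereal_def)
qed

lemma lower_weighted_tendsto:
  assumes "A \<subseteq> posnats"
  shows "(lower_weighted A \<longlongrightarrow> lower_star A) at_top"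
proof -
  have "((\<lambda>\<alpha>. 1 - upper_weighted (posnats - A) \<alpha>) \<longlongrightarrow> 1 - upper_star (posnats - A)) at_top"
    unfolding minus_ereal_def add.commute[of 1]
    by (intro tendsto_add_left_ereal tendsto_uminus_ereal upper_weighted_tendsto) auto
  moreover have "\<forall>\<^sub>F \<alpha> in at_top. 1 - upper_weighted (posnats - A) \<alpha> = lower_weighted A \<alpha>"
    by (rule eventually_mono[OF eventually_gt_at_top[of 0]]) (simp add: lower_weighted_Compl[OF assms])
  ultimately show ?thesis
    unfolding lower_star_Compl[OF assms] by (rule Lim_transform_eventually)
qed

lemma lower_window_tendsto:
  assumes "A \<subseteq> posnats"
  shows "(lower_window A \<longlongrightarrow> lower_star A) (at_left 1)"
proof -
  have "((\<lambda>\<theta>. 1 - upper_window (posnats - A) \<theta>) \<longlongrightarrow> 1 - upper_star (posnats - A)) (at_left 1)"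
    unfolding minus_ereal_def add.commute[of 1]
    by (intro tendsto_add_left_ereal tendsto_uminus_ereal upper_window_tendsto) auto
  moreover have "\<forall>\<^sub>F \<theta> in at_left 1. 1 - upper_window (posnats - A) \<theta> = lower_window A \<theta>"
    using lower_window_Compl[OF assms] by (auto simp: eventually_at_left_field intro!: exI[of _ 0])
  ultimately show ?thesis
    unfolding lower_star_Compl[OF assms] by (rule Lim_transform_eventually)
qed

text \<open>\<open>Lim\<close> is a total operator, so the convergence claims certify that the four
  values defined by it are genuine limits. All upper quantities are identified with
  \<open>upper_star A\<close>, all lower ones with \<open>lower_star A\<close>.\<close>

theorem theorem4p3:
  fixes A :: "nat set"
  assumes "A \<subseteq> posnats"
  shows "((upper_weighted A \<longlongrightarrow> upper_infty A) at_top \<and>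
          (lower_weighted A \<longlongrightarrow> lower_infty A) at_top \<and>
          (upper_window A \<longlongrightarrow> upper_polya A) (at_left 1) \<and>
          (lower_window A \<longlongrightarrow> lower_polya A) (at_left 1)) \<and>
         (upper_dm A = upper_star A \<and> upper_star A = upper_infty A \<and>
          upper_infty A = upper_polya A) \<and>
         (lower_dm A = lower_star A \<and> lower_star A = lower_infty A \<and>
          lower_infty A = lower_polya A)"
proof -
  have "upper_infty A = upper_star A" "lower_infty A = lower_star A"
    "upper_polya A = upper_star A" "lower_polya A = lower_star A"
    using upper_weighted_tendsto[OF assms] lower_weighted_tendsto[OF assms]
      upper_window_tendsto[OF assms] lower_window_tendsto[OF assms]
    by (auto simp: upper_infty_def lower_infty_def upper_polya_def lower_polya_def intro!: tendsto_Lim)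
  moreover have "lower_dm A = lower_star A"
    using lower_dm_Compl[OF assms] lower_star_Compl[OF assms]
      upper_dm_eq_upper_star[of "posnats - A"] by simp
  ultimately show ?thesis
    using upper_weighted_tendsto[OF assms] lower_weighted_tendsto[OF assms]
      upper_window_tendsto[OF assms] lower_window_tendsto[OF assms]
      upper_dm_eq_upper_star[OF assms] by simp
qed

end
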